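(* Let $q$ be a prime power. Choose $b_i\in\mathbb{F}_q$ for $i\in\mathbb{F}_q\cup\{\infty\}$ independently and uniformly at random (so each of the $q^{q+1}$ tuples $(b_i)$ has probability $q^{-(q+1)}$), and let $B=\bigcup_{i\in\mathbb{F}_q\cup\{\infty\}}\ell(i,b_i)$ be the resulting random Besicovitch set. (a) The expected cardinality of $B$ is \[ \mathbb{E}(\#B)=\left(1-\left(1-\frac{1}{q}\right)^{q+1}\right)q^2 = \left(1-\frac{1}{e}\right)q^2 + O(q) \quad\text{as } q \to \infty. \] (b) For $q$ sufficiently large, \[ \left| \#B - \left(1-\frac{1}{e}\right)q^2 \right| < 2q \log q \] holds with probability $1- O((\log q)^{-2})$. In particular, the probability that $B$ is a small Besicovitch set tends to $0$ as $q \to \infty$ (over odd prime powers $q$).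
   Context: $\mathbb{F}_q$ is the finite field with $q$ elements. For $m,b\in\mathbb{F}_q$, $\ell(m,b)$ denotes the line $\{(x,y)\in\mathbb{F}_q^2 : y=mx+b\}$, and for $a\in\mathbb{F}_q$, $\ell(\infty,a)$ denotes the vertical line $\{(x,y): x=a\}$. A Besicovitch set in $\mathbb{F}_q^2$ is a set containing, for each $i\in\mathbb{F}_q\cup\{\infty\}$, some line $\ell(i,b_i)$. For $q$ odd, a Besicovitch set $B\subset\mathbb{F}_q^2$ is called small if $\#B \le \frac{q(q+1)}{2}+\frac{q-1}{2}$. *)

theory Defs
  imports
    "HOL-Probability.Probability"
    "HOL-Library.Landau_Symbols"
    "HOL-Algebra.Ring"
    "HOL-Number_Theory.Prime_Powers"
begin

text \<open>The slope \<open>\<infinity>\<close> is encoded as \<^term>\<open>None\<close>.\<close>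

definition slopes :: "('a, 'b) ring_scheme \<Rightarrow> 'a option set" where
  "slopes R = insert None (Some ` carrier R)"

definition plane :: "('a, 'b) ring_scheme \<Rightarrow> ('a \<times> 'a) set" where
  "plane R = carrier R \<times> carrier R"

fun aff_line :: "('a, 'b) ring_scheme \<Rightarrow> 'a option \<Rightarrow> 'a \<Rightarrow> ('a \<times> 'a) set" where
  "aff_line R (Some m) b = {(x, y) \<in> plane R. y = m \<otimes>\<^bsub>R\<^esub> x \<oplus>\<^bsub>R\<^esub> b}"
| "aff_line R None a = {(x, y) \<in> plane R. x = a}"

definition besicovitch :: "('a, 'b) ring_scheme \<Rightarrow> ('a \<times> 'a) set \<Rightarrow> bool" where
  "besicovitch R S \<longleftrightarrow> S \<subseteq> plane R \<and> (\<forall>i\<in>slopes R. \<exists>b\<in>carrier R. aff_line R i b \<subseteq> S)"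

text \<open>Only meaningful for fields of odd order.\<close>

definition small_besicovitch :: "('a, 'b) ring_scheme \<Rightarrow> ('a \<times> 'a) set \<Rightarrow> bool" where
  "small_besicovitch R S \<longleftrightarrow> besicovitch R S \<and>
     (let q = real (card (carrier R)) in real (card S) \<le> q * (q + 1) / 2 + (q - 1) / 2)"

definition intercept_tuples :: "('a, 'b) ring_scheme \<Rightarrow> ('a option \<Rightarrow> 'a) set" where
  "intercept_tuples R = slopes R \<rightarrow>\<^sub>E carrier R"

definition random_besicovitch :: "('a, 'b) ring_scheme \<Rightarrow> ('a \<times> 'a) set pmf" where
  "random_besicovitch R =
     map_pmf (\<lambda>b. \<Union>i\<in>slopes R. aff_line R i (b i)) (pmf_of_set (intercept_tuples R))"

text \<open>Filters expressing \<open>q \<rightarrow> \<infinity>\<close> along prime powers, respectively odd prime powers.\<close>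

definition at_top_primepow :: "nat filter" where
  "at_top_primepow = inf at_top (principal {q. primepow q})"

definition at_top_odd_primepow :: "nat filter" where
  "at_top_odd_primepow = inf at_top (principal {q. primepow q \<and> odd q})"

lemma pmf_intercept_tuples:
  assumes "finite (carrier R)" and "carrier R \<noteq> {}" and "b \<in> intercept_tuples R"
  shows "pmf (pmf_of_set (intercept_tuples R)) b
           = 1 / real (card (carrier R)) ^ (card (carrier R) + 1)"
proof -
  have fin: "finite (slopes R)" and card: "card (slopes R) = card (carrier R) + 1"
    using assms(1) by (auto simp: slopes_def card_insert_if card_image)
  have "finite (intercept_tuples R)"
    unfolding intercept_tuples_def by (intro finite_PiE fin assms(1))
  moreover have "card (intercept_tuples R) = card (carrier R) ^ (card (carrier R) + 1)"
    unfolding intercept_tuples_def by (simp add: card_PiE fin card)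
  ultimately show ?thesis
    using assms(3) by (subst pmf_of_set) (auto simp: indicator_def)
qed

end

theory Submission
  imports Defs "HOL-Real_Asymp.Real_Asymp"
begin

text \<open>
  A point \<open>P\<close> is missed by \<open>B\<close> iff for every slope \<open>i\<close> the intercept \<open>b\<^sub>i\<close> differs from the
  intercept of the line of slope \<open>i\<close> through \<open>P\<close>, which happens with probability
  \<open>p = (1 - 1/q)\<^bsup>q+1\<^esup>\<close>. Two distinct points lie on a common line for exactly one slope, so both
  are missed with probability \<open>(1 - 1/q) (1 - 2/q)\<^bsup>q\<^esup>\<close>, and this is at most \<open>p\<^sup>2\<close>: the events are
  negatively correlated. Hence the number of missed points has variance at most its mean
  \<open>p q\<^sup>2 \<le> q\<^sup>2\<close>. As \<open>(1 - p) q\<^sup>2\<close> is within \<open>q\<close> of \<open>(1 - 1/e) q\<^sup>2\<close>, Chebyshev's inequality with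
  deviation \<open>q log q\<close> gives the concentration, and \<open>1 - 1/e > 1/2\<close> rules out small sets.
\<close>

section \<open>Independent coordinates and the negative correlation inequality\<close>

text \<open>The tuples avoiding \<open>A i\<close> in every coordinate form again a product, with
  factors \<open>C - A i\<close>. Under the uniform distribution the probability is therefore a
  quotient of two products of cardinalities, which splits factor by factor; this is where
  independence of the coordinates enters.\<close>

lemma prob_PiE_avoid:
  assumes "finite I" "finite C" "C \<noteq> {}" "\<And>i. i \<in> I \<Longrightarrow> A i \<subseteq> C"
  shows "measure_pmf.prob (pmf_of_set (I \<rightarrow>\<^sub>E C)) {b. \<forall>i\<in>I. b i \<notin> A i}
           = (\<Prod>i\<in>I. 1 - real (card (A i)) / real (card C))"
proof -
  have ne: "(I \<rightarrow>\<^sub>E C) \<noteq> {}" using assms by (simp add: PiE_eq_empty_iff)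
  have fin: "finite (I \<rightarrow>\<^sub>E C)" by (intro finite_PiE assms)
  have eq: "(I \<rightarrow>\<^sub>E C) \<inter> {b. \<forall>i\<in>I. b i \<notin> A i} = (\<Pi>\<^sub>E i\<in>I. C - A i)"
    by (auto simp: PiE_iff)
  have cd: "real (card (C - A i)) / real (card C) = 1 - real (card (A i)) / real (card C)"
    if "i \<in> I" for i
  proof -
    have "card (C - A i) = card C - card (A i)" "card (A i) \<le> card C"
      using assms(2) assms(4)[OF that]
      by (auto intro: card_Diff_subset card_mono finite_subset)
    moreover have "card C > 0" using assms by (simp add: card_gt_0_iff)
    ultimately show ?thesis by (simp add: field_simps of_nat_diff)
  qed
  have "measure_pmf.prob (pmf_of_set (I \<rightarrow>\<^sub>E C)) {b. \<forall>i\<in>I. b i \<notin> A i}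
      = real (\<Prod>i\<in>I. card (C - A i)) / real (\<Prod>i\<in>I. card C)"
    by (simp only: measure_pmf_of_set[OF ne fin] eq card_PiE[OF assms(1)])
  also have "\<dots> = (\<Prod>i\<in>I. real (card (C - A i)) / real (card C))"
    by (simp only: of_nat_prod prod_dividef)
  also have "\<dots> = (\<Prod>i\<in>I. 1 - real (card (A i)) / real (card C))"
    by (intro prod.cong refl cd)
  finally show ?thesis .
qed

text \<open>With n = q - 1 and u = n/(n+1) = 1 - 1/q one has 1 - 2/q = u^2 (1 - 1/n^2). The left
  side becomes u^(2q+1) (1 - 1/n^2)^q and the right side is u^(2q+2), so all that remains is (1 -
  1/n^2)^q \<le> u.\<close>

lemma pair_avoid_prob_le:
  assumes "q \<ge> (2::nat)"
  shows "(1 - 1 / real q) * (1 - 2 / real q) ^ q \<le> ((1 - 1 / real q) ^ (q + 1))\<^sup>2"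
proof -
  define n where "n = real q - 1"
  have n: "n \<ge> 1" and q: "real q = n + 1" using assms by (auto simp: n_def)
  define u where "u = 1 - 1 / real q"
  have u: "u = n / (n + 1)" "u > 0" using n by (auto simp: u_def q field_simps)
  have "n\<^sup>2 \<ge> 1" using n by (simp add: power2_eq_square mult_ge1_I)
  hence nonneg: "0 \<le> 1 - 1 / n\<^sup>2" using n by (simp add: field_simps)
  \<comment> \<open>The inequality 1 + x \<le> exp x is applied twice: at x = -1/n^2 to bound the
    power from above, and at x = 1/n to return from exp(-1/n) to u. In between, (n+1)/n^2 \<ge> 1/n
    is all that is used of the exponent q = n + 1.\<close>
  have "(1 - 1 / n\<^sup>2) ^ q \<le> exp (- (1 / n\<^sup>2)) ^ q"
    using exp_ge_add_one_self[of "- (1 / n\<^sup>2)"] nonneg by (intro power_mono) auto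
  also have "\<dots> = exp (- ((n + 1) / n\<^sup>2))"
    by (simp add: exp_of_nat_mult[symmetric] q)
  also have "\<dots> \<le> exp (- (1 / n))"
    using n by (simp add: field_simps power2_eq_square)
  also have "\<dots> = 1 / exp (1 / n)" by (simp add: exp_minus field_simps)
  also have "\<dots> \<le> 1 / (1 + 1 / n)"
    using exp_ge_add_one_self[of "1 / n"] n by (intro divide_left_mono) (auto intro!: mult_pos_pos add_pos_nonneg)
  also have "\<dots> = u" using n by (simp add: u field_simps)
  finally have key: "(1 - 1 / n\<^sup>2) ^ q \<le> u" .
  have two: "1 - 2 / real q = u\<^sup>2 * (1 - 1 / n\<^sup>2)"
  proof -
    have "1 - 2 / real q = (n - 1) / (n + 1)" "1 - 1 / n\<^sup>2 = (n - 1) * (n + 1) / n\<^sup>2"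
      using n by (simp_all add: q field_simps power2_eq_square)
    then show ?thesis using n by (simp add: u power_divide power2_eq_square)
  qed
  have "(1 - 1 / real q) * (1 - 2 / real q) ^ q = u * u ^ (2 * q) * (1 - 1 / n\<^sup>2) ^ q"
    unfolding two by (simp add: u_def power_mult_distrib power_mult)
  also have "\<dots> \<le> u * u ^ (2 * q) * u"
    using u(2) by (intro mult_left_mono key) auto
  also have "\<dots> = (u ^ (q + 1))\<^sup>2"
    by (simp add: power_mult power_mult_distrib power2_eq_square mult_ac)
  finally show ?thesis by (simp add: u_def)
qed

section \<open>Lines, intercepts and incidence\<close>

lemma card_slopes:
  assumes "finite (carrier R)"
  shows "finite (slopes R)" "card (slopes R) = card (carrier R) + 1"
  using assms by (auto simp: slopes_def card_insert_if card_image)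

text \<open>This is the only parameter for which the line of the given slope passes through
  \<open>P\<close>. It turns incidence of \<open>P\<close> with the random lines into conditions on
  single coordinates of the tuple.\<close>

fun intercept :: "('a, 'b) ring_scheme \<Rightarrow> 'a option \<Rightarrow> 'a \<times> 'a \<Rightarrow> 'a" where
  "intercept R (Some m) P = snd P \<ominus>\<^bsub>R\<^esub> m \<otimes>\<^bsub>R\<^esub> fst P"
| "intercept R None P = fst P"

definition line_union :: "('a, 'b) ring_scheme \<Rightarrow> ('a option \<Rightarrow> 'a) \<Rightarrow> ('a \<times> 'a) set" where
  "line_union R b = (\<Union>i\<in>slopes R. aff_line R i (b i))"

lemma line_union_subset_plane: "line_union R b \<subseteq> plane R"
proof -
  have "aff_line R i c \<subseteq> plane R" for i c by (cases i) auto
  thus ?thesis unfolding line_union_def by blast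
qed

context field
begin

lemma minus_eq_zero_iff:
  assumes "a \<in> carrier R" "b \<in> carrier R"
  shows "a \<ominus> b = \<zero> \<longleftrightarrow> a = b"
proof
  assume z: "a \<ominus> b = \<zero>"
  have "a = (a \<ominus> b) \<oplus> b" using assms by algebra
  also have "\<dots> = b" using assms by (simp add: z)
  finally show "a = b" .
qed (use assms in \<open>simp add: minus_eq r_neg\<close>)

lemma intercept_closed:
  assumes "P \<in> plane R" "i \<in> slopes R"
  shows "intercept R i P \<in> carrier R"
  using assms by (auto simp: plane_def slopes_def)

lemma mem_aff_line_iff:
  assumes "P \<in> plane R" "i \<in> slopes R" "c \<in> carrier R"
  shows "P \<in> aff_line R i c \<longleftrightarrow> c = intercept R i P"
proof (cases i)
  case None
  then show ?thesis using assms by (cases P) auto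
next
  case (Some m)
  obtain x y where P: "P = (x, y)" by (cases P)
  have carr: "m \<in> carrier R" "x \<in> carrier R" "y \<in> carrier R"
    using assms Some by (auto simp: P plane_def slopes_def)
  have "y = m \<otimes> x \<oplus> c \<longleftrightarrow> c = y \<ominus> m \<otimes> x"
  proof
    assume "y = m \<otimes> x \<oplus> c"
    then show "c = y \<ominus> m \<otimes> x" using carr assms(3) by algebra
  next
    assume "c = y \<ominus> m \<otimes> x"
    then show "y = m \<otimes> x \<oplus> c" using carr by algebra
  qed
  then show ?thesis using assms(1) by (simp add: P Some)
qed

text \<open>Each slope forbids one value of its coordinate. The forbidden value is written as a
  singleton to fit the shape of \<open>prob_PiE_avoid\<close>.\<close>

lemma notin_line_union_iff:
  assumes "P \<in> plane R" "b \<in> intercept_tuples R"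
  shows "P \<notin> line_union R b \<longleftrightarrow> (\<forall>i\<in>slopes R. b i \<notin> {intercept R i P})"
proof -
  have "b i \<in> carrier R" if "i \<in> slopes R" for i
    using assms(2) that by (auto simp: intercept_tuples_def)
  then show ?thesis
    using mem_aff_line_iff[OF assms(1)] by (auto simp: line_union_def)
qed

text \<open>Equal intercepts mean a common line of that slope, and two distinct points span one
  line. At a finite slope m the condition reads m (x - x') = y - y'. If x = x', then y and y'
  differ, no finite m solves it, and the slope is \<open>None\<close>; otherwise the unique solution
  is the quotient \<open>k\<close>, and the vertical lines through the points differ.\<close>

lemma common_intercept:
  assumes "P \<in> plane R" "Q \<in> plane R" "P \<noteq> Q"
  obtains j where "j \<in> slopes R" "\<And>i. i \<in> slopes R \<Longrightarrow> intercept R i P = intercept R i Q \<longleftrightarrow> i = j"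
proof -
  obtain x y where P: "P = (x, y)" by (cases P)
  obtain x' y' where Q: "Q = (x', y')" by (cases Q)
  have carr [simp]: "x \<in> carrier R" "y \<in> carrier R" "x' \<in> carrier R" "y' \<in> carrier R"
    using assms by (auto simp: P Q plane_def)
  have iff: "intercept R (Some m) P = intercept R (Some m) Q \<longleftrightarrow> m \<otimes> (x \<ominus> x') = y \<ominus> y'"
    if m: "m \<in> carrier R" for m
  proof
    assume "intercept R (Some m) P = intercept R (Some m) Q"
    then have eq: "y \<ominus> m \<otimes> x = y' \<ominus> m \<otimes> x'" by (simp add: P Q)
    have "y \<ominus> y' = (y \<ominus> m \<otimes> x) \<oplus> (m \<otimes> x \<ominus> y')" using carr m by algebra
    also have "\<dots> = m \<otimes> (x \<ominus> x')" unfolding eq using carr m by algebra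
    finally show "m \<otimes> (x \<ominus> x') = y \<ominus> y'" by simp
  next
    assume eq: "m \<otimes> (x \<ominus> x') = y \<ominus> y'"
    have "y \<ominus> m \<otimes> x = (y \<ominus> y') \<oplus> (y' \<ominus> m \<otimes> x)" using carr m by algebra
    also have "\<dots> = y' \<ominus> m \<otimes> x'" unfolding eq[symmetric] using carr m by algebra
    finally show "intercept R (Some m) P = intercept R (Some m) Q" by (simp add: P Q)
  qed
  show ?thesis
  proof (cases "x = x'")
    case True
    then have "y \<noteq> y'" using assms(3) by (simp add: P Q)
    then have "y \<ominus> y' \<noteq> \<zero>" by (simp add: minus_eq_zero_iff)
    then show ?thesis using True iff
      by (intro that[of None]) (auto simp: slopes_def P Q r_neg minus_eq)
  next
    case False
    then have d: "x \<ominus> x' \<in> Units R" by (simp add: field_Units minus_eq_zero_iff)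
    define k where "k = (y \<ominus> y') \<otimes> inv (x \<ominus> x')"
    have [simp]: "k \<in> carrier R" using d by (simp add: k_def)
    have "m \<otimes> (x \<ominus> x') = y \<ominus> y' \<longleftrightarrow> m = k" if [simp]: "m \<in> carrier R" for m
    proof
      assume "m \<otimes> (x \<ominus> x') = y \<ominus> y'"
      then show "m = k" using d by (metis k_def Units_closed Units_inv_closed Units_r_inv m_assoc r_one that)
    next
      assume "m = k"
      then show "m \<otimes> (x \<ominus> x') = y \<ominus> y'" using d by (simp add: k_def m_assoc)
    qed
    then show ?thesis using False iff
      by (intro that[of "Some k"]) (auto simp: slopes_def P Q)
  qed
qed

end

section \<open>First and second moments of the number of missed points\<close>

locale finite_field = field +
  assumes finite_carrier: "finite (carrier R)"
begin

abbreviation q :: nat where "q \<equiv> card (carrier R)"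
abbreviation tuples :: "('a option \<Rightarrow> 'a) pmf" where "tuples \<equiv> pmf_of_set (intercept_tuples R)"
abbreviation avoid :: real where "avoid \<equiv> (1 - 1 / real q) ^ (q + 1)"

lemma q_ge_2: "q \<ge> 2"
proof -
  have "card {\<zero>, \<one>} \<le> q" by (intro card_mono finite_carrier) auto
  then show ?thesis by simp
qed

lemma carrier_nonempty: "carrier R \<noteq> {}"
  by auto

lemma finite_plane: "finite (plane R)" and card_plane: "card (plane R) = q\<^sup>2"
  using finite_carrier by (simp_all add: plane_def power2_eq_square)

lemma set_tuples: "set_pmf tuples = intercept_tuples R" and finite_tuples: "finite (set_pmf tuples)"
proof -
  have "finite (intercept_tuples R)" "intercept_tuples R \<noteq> {}"
    unfolding intercept_tuples_def
    by (auto intro!: finite_PiE simp: card_slopes finite_carrier PiE_eq_empty_iff)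
  then show "set_pmf tuples = intercept_tuples R" "finite (set_pmf tuples)" by simp_all
qed

lemma integrable_tuples: "integrable (measure_pmf tuples) (f :: _ \<Rightarrow> real)"
  by (rule integrable_measure_pmf_finite[OF finite_tuples])

text \<open>The set of forbidden values has one or two elements depending on the slope. Keeping its
  cardinality in the formula, and allowing \<open>P = Q\<close>, covers single points and pairs at
  once.\<close>

lemma prob_pair_uncovered:
  assumes "P \<in> plane R" "Q \<in> plane R"
  shows "measure_pmf.prob tuples {b. P \<notin> line_union R b \<and> Q \<notin> line_union R b}
    = (\<Prod>i\<in>slopes R. 1 - real (card {intercept R i P, intercept R i Q}) / real q)"
proof -
  \<comment> \<open>The two events need not coincide as sets of functions, since incidence is
    described by intercepts only for tuples with values in the carrier; they agree on the support,
    which suffices.\<close>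
  have "measure_pmf.prob tuples {b. P \<notin> line_union R b \<and> Q \<notin> line_union R b}
      = measure_pmf.prob tuples {b. \<forall>i\<in>slopes R. b i \<notin> {intercept R i P, intercept R i Q}}"
    using notin_line_union_iff[OF assms(1)] notin_line_union_iff[OF assms(2)]
    by (intro measure_pmf.finite_measure_eq_AE) (auto simp: AE_measure_pmf_iff set_tuples)
  also have "\<dots> = (\<Prod>i\<in>slopes R. 1 - real (card {intercept R i P, intercept R i Q}) / real q)"
    unfolding intercept_tuples_def using assms
    by (intro prob_PiE_avoid finite_carrier carrier_nonempty card_slopes)
       (auto intro: intercept_closed)
  finally show ?thesis .
qed

lemma prob_uncovered:
  assumes "P \<in> plane R"
  shows "measure_pmf.prob tuples {b. P \<notin> line_union R b} = avoid"
  using prob_pair_uncovered[OF assms assms] by (simp add: card_slopes finite_carrier)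

text \<open>Of the q + 1 slopes, the slope of the line through both points forbids one value, and
  each of the other q forbids two. This gives (1 - 1/q) (1 - 2/q)^q, to which
  \<open>pair_avoid_prob_le\<close> applies.\<close>

lemma prob_pair_uncovered_le:
  assumes "P \<in> plane R" "Q \<in> plane R" "P \<noteq> Q"
  shows "measure_pmf.prob tuples {b. P \<notin> line_union R b \<and> Q \<notin> line_union R b} \<le> avoid\<^sup>2"
proof -
  obtain j where j: "j \<in> slopes R"
    "\<And>i. i \<in> slopes R \<Longrightarrow> intercept R i P = intercept R i Q \<longleftrightarrow> i = j"
    using common_intercept[OF assms] by blast
  let ?f = "\<lambda>i. 1 - real (card {intercept R i P, intercept R i Q}) / real q"
  have fin: "finite (slopes R)" by (intro card_slopes finite_carrier)
  have "(\<Prod>i\<in>slopes R. ?f i) = ?f j * (\<Prod>i\<in>slopes R - {j}. ?f i)"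
    using fin j(1) by (rule prod.remove)
  also have "?f j = 1 - 1 / real q" using j(2)[OF j(1)] by simp
  also have "(\<Prod>i\<in>slopes R - {j}. ?f i) = (\<Prod>i\<in>slopes R - {j}. 1 - 2 / real q)"
    using j by (intro prod.cong refl) (auto simp: card_insert_if)
  also have "\<dots> = (1 - 2 / real q) ^ q"
    using j(1) fin by (simp add: card_slopes finite_carrier)
  finally show ?thesis
    using pair_avoid_prob_le[OF q_ge_2] by (simp add: prob_pair_uncovered[OF assms(1,2)])
qed

text \<open>The sum of indicators makes the mean a sum over points and the second moment a sum over
  pairs of points.\<close>

definition uncovered :: "('a option \<Rightarrow> 'a) \<Rightarrow> real" where
  "uncovered b = (\<Sum>P\<in>plane R. indicator {b. P \<notin> line_union R b} b)"

lemma card_line_union: "real (card (line_union R b)) = (real q)\<^sup>2 - uncovered b"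
proof -
  have "uncovered b = real (card (plane R - line_union R b))"
    unfolding uncovered_def indicator_def
    by (simp add: finite_plane sum.If_cases set_diff_eq Int_def)
  also have "\<dots> = real (card (plane R)) - real (card (line_union R b))"
    using finite_plane line_union_subset_plane[of R b]
    by (subst card_Diff_subset) (auto simp: of_nat_diff card_mono intro: finite_subset)
  finally show ?thesis by (simp add: card_plane)
qed

lemma expectation_uncovered: "measure_pmf.expectation tuples uncovered = avoid * (real q)\<^sup>2"
  unfolding uncovered_def
  by (simp add: integrable_tuples prob_uncovered card_plane del: power_Suc)

lemma expectation_uncovered_square_le:
  "measure_pmf.expectation tuples (\<lambda>b. (uncovered b)\<^sup>2)
     \<le> avoid * (real q)\<^sup>2 + (avoid * (real q)\<^sup>2)\<^sup>2"
proof -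
  let ?pr = "\<lambda>P Q. measure_pmf.prob tuples {b. P \<notin> line_union R b \<and> Q \<notin> line_union R b}"
  have "(uncovered b)\<^sup>2 = (\<Sum>P\<in>plane R. \<Sum>Q\<in>plane R.
      indicator {b. P \<notin> line_union R b \<and> Q \<notin> line_union R b} b)" for b
    unfolding uncovered_def power2_eq_square sum_product
    by (intro sum.cong refl) (auto simp: indicator_def)
  then have "measure_pmf.expectation tuples (\<lambda>b. (uncovered b)\<^sup>2) = (\<Sum>P\<in>plane R. \<Sum>Q\<in>plane R. ?pr P Q)"
    by (simp add: integrable_tuples)
  \<comment> \<open>Diagonal terms equal \<open>avoid\<close> and the others are at most its square.
    Adding \<open>avoid\<^sup>2\<close> on the diagonal as well only weakens the bound and makes the
    total exactly the mean plus its square.\<close>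
  also have "\<dots> \<le> (\<Sum>P\<in>plane R. \<Sum>Q\<in>plane R. (if P = Q then avoid else 0) + avoid\<^sup>2)"
  proof (intro sum_mono)
    fix P Q assume "P \<in> plane R" "Q \<in> plane R"
    then show "?pr P Q \<le> (if P = Q then avoid else 0) + avoid\<^sup>2"
      using prob_pair_uncovered_le[of P Q] prob_uncovered[of P] by (cases "P = Q") auto
  qed
  also have "\<dots> = avoid * (real q)\<^sup>2 + (avoid * (real q)\<^sup>2)\<^sup>2"
    by (simp add: sum.distrib finite_plane card_plane power_mult_distrib power2_eq_square distrib_left mult_ac
        del: power_Suc power_add)
  finally show ?thesis .
qed

lemma random_besicovitch_eq: "random_besicovitch R = map_pmf (line_union R) tuples"
  by (simp add: random_besicovitch_def line_union_def[abs_def])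

lemma expectation_card:
  "measure_pmf.expectation (random_besicovitch R) (\<lambda>B. real (card B)) = (1 - avoid) * (real q)\<^sup>2"
  by (simp add: random_besicovitch_eq card_line_union integrable_tuples expectation_uncovered
      algebra_simps del: power_Suc)

text \<open>The cardinality is a constant minus \<open>uncovered\<close>, so both have the same
  variance. The squared mean cancels against the second moment bound, leaving at most the mean of
  \<open>uncovered\<close>.\<close>

lemma variance_card_le:
  "measure_pmf.variance (random_besicovitch R) (\<lambda>B. real (card B)) \<le> (real q)\<^sup>2"
proof -
  have "measure_pmf.variance (random_besicovitch R) (\<lambda>B. real (card B))
      = measure_pmf.variance tuples uncovered"
    unfolding expectation_card expectation_uncovered
    by (simp add: random_besicovitch_eq card_line_union power2_commute algebra_simps del: power_Suc)
  also have "\<dots> = measure_pmf.expectation tuples (\<lambda>b. (uncovered b)\<^sup>2) - (avoid * (real q)\<^sup>2)\<^sup>2"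
    by (subst measure_pmf.variance_eq) (simp_all add: integrable_tuples expectation_uncovered)
  also have "\<dots> \<le> avoid * (real q)\<^sup>2"
    using expectation_uncovered_square_le by simp
  also have "\<dots> \<le> 1 * (real q)\<^sup>2"
    using q_ge_2 by (intro mult_right_mono power_le_one) auto
  finally show ?thesis by simp
qed

lemma prob_card_deviation_le:
  assumes "a > 0"
  shows "measure_pmf.prob (random_besicovitch R)
           {B. \<bar>real (card B) - (1 - avoid) * (real q)\<^sup>2\<bar> \<ge> a} \<le> (real q)\<^sup>2 / a\<^sup>2"
proof -
  have "finite (set_pmf (random_besicovitch R))"
    by (simp add: random_besicovitch_eq finite_tuples)
  then have "integrable (random_besicovitch R) (\<lambda>B. (real (card B))\<^sup>2)"
    by (rule integrable_measure_pmf_finite)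
  from measure_pmf.Chebyshev_inequality[OF _ this assms]
  have "measure_pmf.prob (random_besicovitch R)
           {B. \<bar>real (card B) - (1 - avoid) * (real q)\<^sup>2\<bar> \<ge> a}
      \<le> measure_pmf.variance (random_besicovitch R) (\<lambda>B. real (card B)) / a\<^sup>2"
    by (simp add: expectation_card)
  also have "\<dots> \<le> (real q)\<^sup>2 / a\<^sup>2"
    by (intro divide_right_mono variance_card_le) auto
  finally show ?thesis .
qed

end

section \<open>Asymptotics of the mean and of the threshold for small sets\<close>

text \<open>With u = 1 - 1/q, the power u^(q+1) lies between (1 - 2/q)/e and 1/e. The gap is at most
  2/(e q) \<le> 1/q, and multiplication by q^2 turns it into q.\<close>

lemma mean_error:
  assumes "q \<ge> (2::nat)"
  shows "\<bar>(1 - (1 - 1 / real q) ^ (q + 1)) * real q ^ 2 - (1 - 1 / exp 1) * real q ^ 2\<bar> \<le> real q"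
proof -
  define n where "n = q - 1"
  have n: "n \<ge> 1" and q: "q = n + 1" using assms by (auto simp: n_def)
  define u where "u = 1 - 1 / real q"
  have u: "u = real n / (real n + 1)" "0 < u" "u \<le> 1" using n by (auto simp: u_def q field_simps)
  have "u ^ q \<le> exp (- (1 / real q)) ^ q"
    using exp_ge_add_one_self[of "- (1 / real q)"] u by (intro power_mono) (auto simp: u_def)
  also have "\<dots> = exp (- 1)" using assms by (simp flip: exp_of_nat_mult)
  finally have "u ^ q \<le> exp (- 1)" .
  moreover have "u ^ (q + 1) \<le> u ^ q" using u by (intro power_decreasing) auto
  ultimately have upper: "u ^ (q + 1) \<le> exp (- 1)" by linarith
  \<comment> \<open>For the lower bound, u = 1/(1 + 1/n) with n = q - 1 gives u^n \<ge> 1/e; the two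
    remaining factors of u^(q+1) = u^n u^2 cost only u^2 \<ge> 1 - 2/q.\<close>
  have "exp (- (1 / real n)) = 1 / exp (1 / real n)" by (simp add: exp_minus field_simps)
  also have "\<dots> \<le> 1 / (1 + 1 / real n)"
    using exp_ge_add_one_self[of "1 / real n"]
    by (intro divide_left_mono) (auto intro!: mult_pos_pos add_pos_nonneg)
  also have "\<dots> = u" using n by (simp add: u field_simps)
  finally have "exp (- (1 / real n)) ^ n \<le> u ^ n" by (intro power_mono) auto
  then have "exp (- 1) \<le> u ^ n" using n by (simp flip: exp_of_nat_mult)
  then have "exp (- 1) * u\<^sup>2 \<le> u ^ n * u\<^sup>2" by (intro mult_right_mono) auto
  also have "\<dots> = u ^ (q + 1)" by (simp add: q power2_eq_square)
  finally have "exp (- 1) * u\<^sup>2 \<le> u ^ (q + 1)" .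
  moreover have "exp (- 1) * (1 - 2 / real q) \<le> exp (- 1) * u\<^sup>2"
    by (intro mult_left_mono) (auto simp: u_def power2_eq_square algebra_simps)
  ultimately have "exp (- 1) - u ^ (q + 1) \<le> exp (- 1) * 2 / real q"
    by (simp add: algebra_simps)
  \<comment> \<open>The factor 2 is absorbed because e \<ge> 2.\<close>
  also have "\<dots> \<le> 1 / real q"
    using exp_ge_add_one_self[of 1] by (intro divide_right_mono) (auto simp: exp_minus field_simps)
  finally have "(exp (- 1) - u ^ (q + 1)) * real q ^ 2 \<le> 1 / real q * real q ^ 2"
    by (intro mult_right_mono) auto
  then have "(exp (- 1) - u ^ (q + 1)) * real q ^ 2 \<le> real q"
    using assms by (simp add: power2_eq_square)
  moreover have "0 \<le> (exp (- 1) - u ^ (q + 1)) * real q ^ 2" using upper by simp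
  moreover have "(1 - u ^ (q + 1)) * real q ^ 2 - (1 - 1 / exp 1) * real q ^ 2
      = (exp (- 1) - u ^ (q + 1)) * real q ^ 2"
    by (simp add: exp_minus field_simps)
  ultimately show ?thesis unfolding u_def by linarith
qed

text \<open>The quadratic coefficients decide: 1/2 on the left against 1 - 1/e > 1/2 on the right,
  because e > 2. All other terms are of order at most q log q.\<close>

lemma small_bound_below_mean:
  "\<forall>\<^sub>F q in at_top. real q * (real q + 1) / 2 + (real q - 1) / 2
     < (1 - 1 / exp 1) * real q ^ 2 - 2 * real q * ln (real q)"
proof -
  define c :: real where "c = 1 - 1 / exp 1"
  have "exp 1 > (2::real)" using exp_lower_Taylor_quadratic[of 1] by simp
  then have "c > 1 / 2" by (simp add: c_def field_simps)
  then have "\<forall>\<^sub>F q in at_top. real q * (real q + 1) / 2 + (real q - 1) / 2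
      < c * real q ^ 2 - 2 * real q * ln (real q)"
    by real_asymp
  then show ?thesis by (simp add: c_def)
qed

section \<open>Concentration and the limit for small sets\<close>

text \<open>\<open>F\<close> supplies one field for each prime power, so that expectations and
  probabilities become functions of q; the filters disregard the values at all other q.\<close>

theorem theorem3:
  fixes F :: "nat \<Rightarrow> 'a ring"
  assumes "\<And>q. primepow q \<Longrightarrow> field (F q)"
    and "\<And>q. primepow q \<Longrightarrow> finite (carrier (F q))"
    and "\<And>q. primepow q \<Longrightarrow> card (carrier (F q)) = q"
  shows
    "(\<forall>q. primepow q \<longrightarrow>
       measure_pmf.expectation (random_besicovitch (F q)) (\<lambda>B. real (card B))
         = (1 - (1 - 1 / real q) ^ (q + 1)) * real q ^ 2)
     \<and> (\<lambda>q. measure_pmf.expectation (random_besicovitch (F q)) (\<lambda>B. real (card B))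
            - (1 - 1 / exp 1) * real q ^ 2)
         \<in> O[at_top_primepow](\<lambda>q. real q)
     \<and> (\<lambda>q. measure_pmf.prob (random_besicovitch (F q))
              {B. \<bar>real (card B) - (1 - 1 / exp 1) * real q ^ 2\<bar> < 2 * real q * ln (real q)} - 1)
         \<in> O[at_top_primepow](\<lambda>q. 1 / ln (real q) ^ 2)
     \<and> ((\<lambda>q. measure_pmf.prob (random_besicovitch (F q)) {B. small_besicovitch (F q) B})
         \<longlongrightarrow> 0) at_top_odd_primepow"
proof -
  have ff: "finite_field (F q)" if "primepow q" for q
    using assms that by (simp add: finite_field_def finite_field_axioms_def)
  define E where "E q = (1 - (1 - 1 / real q) ^ (q + 1)) * real q ^ 2" for q
  define c where "c q = (1 - 1 / exp 1) * real q ^ 2" for q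
  define good where "good q = {B :: ('a \<times> 'a) set. \<bar>real (card B) - c q\<bar> < 2 * real q * ln (real q)}" for q
  define pr where "pr q = measure_pmf.prob (random_besicovitch (F q))" for q
  have expect: "measure_pmf.expectation (random_besicovitch (F q)) (\<lambda>B. real (card B)) = E q"
    if "primepow q" for q
    using finite_field.expectation_card[OF ff[OF that]] assms(3)[OF that] by (simp add: E_def)
  have pp: "eventually primepow at_top_primepow"
    by (simp add: at_top_primepow_def eventually_inf_principal)
  have le: "at_top_primepow \<le> at_top" by (simp add: at_top_primepow_def)
  have oddle: "at_top_odd_primepow \<le> at_top_primepow"
    unfolding at_top_primepow_def at_top_odd_primepow_def by (intro inf_mono) auto

  have q2: "q \<ge> 2" if "primepow q" for q :: nat
    using primepow_gt_Suc_0[OF that] by simp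
  have mean: "\<bar>E q - c q\<bar> \<le> real q" if "primepow q" for q
    using mean_error[OF q2[OF that]] by (simp add: E_def c_def)
  have b: "(\<lambda>q. measure_pmf.expectation (random_besicovitch (F q)) (\<lambda>B. real (card B)) - c q)
      \<in> O[at_top_primepow](\<lambda>q. real q)"
    using pp by (intro bigoI[of _ 1]) (auto elim!: eventually_mono simp: expect mean)

  have "\<forall>\<^sub>F q :: nat in at_top. 1 \<le> ln (real q)"
    by real_asymp
  then have "\<forall>\<^sub>F q :: nat in at_top_primepow. 1 \<le> ln (real q)"
    by (rule filter_leD[OF le])
  with pp have bound: "\<forall>\<^sub>F q in at_top_primepow. \<bar>pr q (good q) - 1\<bar> \<le> 1 / ln (real q) ^ 2"
  proof eventually_elim
    case (elim q)
    \<comment> \<open>The allowed deviation 2 q log q is split into two halves \<open>a\<close>: one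
      covers the distance from the true mean \<open>E q\<close> to \<open>c q\<close>, which is at
      most q \<le> a once log q \<ge> 1, and the other is spent on Chebyshev's inequality.\<close>
    define a where "a = real q * ln (real q)"
    have a: "a > 0" using elim q2[of q] by (simp add: a_def)
    have "real q \<le> a" using elim mult_left_mono[of 1 "ln (real q)" "real q"] by (simp add: a_def)
    then have "\<bar>E q - c q\<bar> \<le> a" using mean[of q] elim by simp
    then have "pr q (UNIV - good q) \<le> pr q {B. \<bar>real (card B) - E q\<bar> \<ge> a}"
      unfolding pr_def using elim
      by (intro measure_pmf.finite_measure_mono) (auto simp: good_def a_def)
    moreover have "1 - pr q (good q) = pr q (UNIV - good q)"
      unfolding pr_def using measure_pmf.prob_compl[of "good q"] by simp
    moreover have "pr q {B. \<bar>real (card B) - E q\<bar> \<ge> a} \<le> (real q)\<^sup>2 / a\<^sup>2"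
      using finite_field.prob_card_deviation_le[OF ff[of q] a] elim assms(3)[of q]
      by (simp add: pr_def E_def)
    moreover have "(real q)\<^sup>2 / a\<^sup>2 = 1 / ln (real q) ^ 2"
      using q2[of q] elim by (simp add: a_def power_mult_distrib)
    moreover have "pr q (good q) \<le> 1" by (simp add: pr_def)
    ultimately show ?case by linarith
  qed
  have d: "(\<lambda>q. pr q (good q) - 1) \<in> O[at_top_primepow](\<lambda>q. 1 / ln (real q) ^ 2)"
    using bound by (intro bigoI[of _ 1]) (auto elim!: eventually_mono)

  have "((\<lambda>q. pr q {B. small_besicovitch (F q) B}) \<longlongrightarrow> 0) at_top_odd_primepow"
  proof (rule tendsto_sandwich[of "\<lambda>_. 0" _ _ "\<lambda>q. 1 / ln (real q) ^ 2"])
    have "((\<lambda>q. 1 / ln (real q) ^ 2) \<longlongrightarrow> 0) at_top" by real_asymp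
    then show "((\<lambda>q. 1 / ln (real q) ^ 2) \<longlongrightarrow> 0) at_top_odd_primepow"
      using oddle le by (meson order_trans tendsto_mono)
    have "\<forall>\<^sub>F q in at_top_primepow. pr q {B. small_besicovitch (F q) B} \<le> 1 / ln (real q) ^ 2"
      using bound pp filter_leD[OF le small_bound_below_mean]
    proof eventually_elim
      case (elim q)
      \<comment> \<open>For such q the size bound for small sets lies below c q - 2 q log q, so
        every small set falls outside \<open>good q\<close>.\<close>
      have "pr q {B. small_besicovitch (F q) B} \<le> pr q (UNIV - good q)"
        unfolding pr_def using elim assms(3)[of q]
        by (intro measure_pmf.finite_measure_mono)
           (auto simp: good_def c_def small_besicovitch_def Let_def)
      also have "\<dots> = 1 - pr q (good q)"
        unfolding pr_def using measure_pmf.prob_compl[of "good q"] by simp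
      finally show ?case using elim by simp
    qed
    then show "\<forall>\<^sub>F q in at_top_odd_primepow. pr q {B. small_besicovitch (F q) B} \<le> 1 / ln (real q) ^ 2"
      by (rule filter_leD[OF oddle])
  qed (auto simp: pr_def)
  with b d expect show ?thesis
    by (simp add: E_def c_def good_def pr_def)
qed

end
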